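(* Let $\phi:E\to\,]-\infty,+\infty]$ be continuous. Let $(x_n)_{n\in\mathbb{N}}$ and $x$ be in $L^1_E(S,\mu)$ such that $(x_n)_{n\in\mathbb{N}}$ converges to $x$ in measure. Assume that there exists $M>0$ such that $|\phi(v)|\le M$ for all $v\in E$. Suppose that one of the following conditions holds: (i) $x\in L^\infty_E(S,\mu)$; or (ii) $\phi$ is uniformly continuous (in particular, when $\phi$ is globally Lipschitz). Then $\int_S|\phi(x_n(s))-\phi(x(s))|\,d\mu(s)\to 0$. Consequently, $I_\phi(x_n)\to I_\phi(x)$.
   Context: $d\in\{1,2,3,\dots\}$ and $E=\mathbb{R}^d$ is Euclidean space with its Euclidean norm. $(S,\mu)$ is a complete finite measure space with $\mu\neq 0$. $L^1_E(S,\mu)$ is the Banach space of (equivalence classes of) measurable $f:S\to E$ with $\int_S\|f(s)\|\,d\mu(s)<+\infty$, and $L^\infty_E(S,\mu)$ the space of essentially bounded measurable $f:S\to E$. The integral functional is $I_\phi(x):=\int_S\phi(x(s))\,d\mu(s)$ for $x\in L^1_E(S,\mu)$. A sequence $(x_n)$ converges to $x$ in measure if for every $\eta>0$, $\lim_{n}\mu\{s\in S:\|x_n(s)-x(s)\|\ge\eta\}=0$. *)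

theory Defs
  imports "HOL-Analysis.Analysis"
begin

text \<open>
  Elements of the Lebesgue spaces are represented by functions rather than by equivalence classes
  modulo null sets; all notions below are invariant under changes on null sets. Membership in the
  space of integrable functions is the Bochner notion \<^const>\<open>integrable\<close>.
\<close>

definition Linf_space :: "'a measure \<Rightarrow> ('a \<Rightarrow> 'e::euclidean_space) set" where
  "Linf_space S = {f. f \<in> borel_measurable S \<and> (\<exists>C::real. AE s in S. norm (f s) \<le> C)}"

definition converges_in_measure ::
    "'a measure \<Rightarrow> (nat \<Rightarrow> 'a \<Rightarrow> 'e::euclidean_space) \<Rightarrow> ('a \<Rightarrow> 'e) \<Rightarrow> bool" where
  "converges_in_measure S f g \<longleftrightarrow>
     (\<forall>\<eta>::real>0. (\<lambda>n. emeasure S {s \<in> space S. norm (f n s - g s) \<ge> \<eta>}) \<longlonglongrightarrow> 0)"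

text \<open>
  The integral of an extended-real function as the integral of its positive part minus that of its
  negative part: \<^const>\<open>e2ennreal\<close> maps negative values to 0. The case
  \<open>\<infinity> - \<infinity>\<close> takes the value \<open>\<infinity>\<close> of \<^typ>\<open>ereal\<close> subtraction,
  the usual convention for integral functionals.
\<close>

definition ereal_integral :: "'a measure \<Rightarrow> ('a \<Rightarrow> ereal) \<Rightarrow> ereal" where
  "ereal_integral S g =
     enn2ereal (\<integral>\<^sup>+s. e2ennreal (g s) \<partial>S) - enn2ereal (\<integral>\<^sup>+s. e2ennreal (- g s) \<partial>S)"

definition integral_functional ::
    "'a measure \<Rightarrow> ('e::euclidean_space \<Rightarrow> ereal) \<Rightarrow> ('a \<Rightarrow> 'e) \<Rightarrow> ereal" where
  "integral_functional S \<phi> x = ereal_integral S (\<lambda>s. \<phi> (x s))"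

end

theory Submission
  imports Defs
begin

text \<open>
  By Markov's inequality \<open>x\<close> stays in a ball of radius \<open>R\<close> outside a set of small
  measure, and the integrand \<open>f\<close> is uniformly continuous on the compact ball of radius
  \<open>R + 1\<close> with some modulus \<open>d \<le> 1\<close>. Hence \<open>\<bar>f (x n) - f x\<bar>\<close> is small except where
  \<open>norm x \<ge> R\<close> or \<open>norm (x n - x) \<ge> d\<close>, and there it is at most twice the bound of \<open>f\<close>.
\<close>

text \<open>Integrability makes both the positive and the negative part have finite integral, so the
  subtraction never meets \<open>\<infinity> - \<infinity>\<close> and agrees with the difference
  that defines the Bochner integral of a real function.\<close>

lemma ereal_integral_ereal:
  assumes "integrable S g"
  shows "ereal_integral S (\<lambda>s. ereal (g s)) = ereal (integral\<^sup>L S g)"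
proof -
  have fin: "(\<integral>\<^sup>+s. ennreal (g s) \<partial>S) < top" "(\<integral>\<^sup>+s. ennreal (- g s) \<partial>S) < top"
    using assms by (auto simp: real_integrable_def top.not_eq_extremum)
  have enn: "enn2ereal a = ereal (enn2real a)" if "a < top" for a
    using that by (metis enn2ereal_ennreal enn2real_nonneg ennreal_enn2real)
  show ?thesis
    unfolding ereal_integral_def
    by (simp add: enn fin real_lebesgue_integral_def[OF assms])
qed

lemma continuous_bounded_integrable_comp:
  fixes f :: "'e::euclidean_space \<Rightarrow> real"
  assumes "finite_measure S" "continuous_on UNIV f" "\<And>v. \<bar>f v\<bar> \<le> M" "u \<in> borel_measurable S"
  shows "integrable S (\<lambda>s. f (u s))"
proof -
  interpret finite_measure S by fact
  have "f \<in> borel_measurable borel"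
    using assms(2) by (rule borel_measurable_continuous_onI)
  then show ?thesis
    using assms by (intro integrable_const_bound[where B = M]) auto
qed

lemma bounded_continuous_converges_in_mean:
  fixes f :: "'e::euclidean_space \<Rightarrow> real"
  assumes "finite_measure S" and cont: "continuous_on UNIV f" and bd: "\<And>v. \<bar>f v\<bar> \<le> M"
    and [measurable]: "\<And>n. xs n \<in> borel_measurable S" and x: "integrable S x"
    and conv: "converges_in_measure S xs x"
  shows "(\<lambda>n. \<integral>s. \<bar>f (xs n s) - f (x s)\<bar> \<partial>S) \<longlonglongrightarrow> 0"
proof (rule LIMSEQ_I)
  interpret finite_measure S by fact
  have [measurable]: "x \<in> borel_measurable S"
    using x by simp
  fix e :: real
  assume "0 < e"
  have M0: "0 \<le> M"
    using bd[of undefined] by linarith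
  \<comment> \<open>The error \<open>e\<close> is split into thirds: one for the uniform modulus
    over the whole space, one for the set \<open>A\<close>, one for \<open>B n\<close>. The summand
    1 keeps the denominator positive even for a null measure.\<close>
  define c where "c = e / (4 * (measure S (space S) + 1))"
  have c: "c > 0" "c * measure S (space S) < e / 3"
    using \<open>0 < e\<close> by (auto simp: c_def field_simps add_pos_nonneg intro: add_nonneg_pos)
  \<comment> \<open>The measure allowed for \<open>A\<close>. Since only \<open>0 \<le> M\<close> is
    known here, the denominator uses \<open>M + 1\<close>.\<close>
  define r where "r = e / (6 * (M + 1))"
  have r: "r > 0" "2 * M * r < e / 3"
    using \<open>0 < e\<close> M0 by (auto simp: r_def field_simps)
  \<comment> \<open>Exceeds the integral of \<open>norm (x s)\<close> divided by \<open>r\<close>,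
    so Markov's bound on \<open>A\<close> is at most \<open>r\<close>; the summand 1 keeps
    \<open>R\<close> positive when that integral is 0.\<close>
  define R where "R = (\<integral>s. norm (x s) \<partial>S) / r + 1"
  have I0: "0 \<le> (\<integral>s. norm (x s) \<partial>S)"
    by simp
  have R: "R > 0"
    using I0 r unfolding R_def by (simp add: add_nonneg_pos)
  define A where "A = {s \<in> space S. norm (x s) \<ge> R}"
  have [measurable]: "A \<in> sets S"
    unfolding A_def by measurable
  have "measure S A \<le> (\<integral>s. norm (x s) \<partial>S) / R"
    unfolding A_def using x R by (intro integral_Markov_inequality_measure[where A = "{}"]) auto
  also have "\<dots> \<le> r"
    using R r by (simp add: R_def field_simps)
  finally have A: "2 * M * measure S A < e / 3"
    using r M0 by (smt (verit) mult_left_mono)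
  \<comment> \<open>The radius leaves a margin of 1: where \<open>norm (x s) < R\<close> and
    \<open>xs n s\<close> is closer than \<open>d \<le> 1\<close> to \<open>x s\<close>, both points
    lie in this ball.\<close>
  have "uniformly_continuous_on (cball 0 (R + 1)) f"
    by (intro compact_uniformly_continuous continuous_on_subset[OF cont]) auto
  then obtain d0 where d0: "d0 > 0"
    "\<And>u v. \<lbrakk>u \<in> cball 0 (R + 1); v \<in> cball 0 (R + 1); dist v u < d0\<rbrakk> \<Longrightarrow> dist (f v) (f u) < c"
    using \<open>c > 0\<close> unfolding uniformly_continuous_on_def by metis
  define d where "d = min d0 1"
  have d: "d > 0" "d \<le> 1" "d \<le> d0"
    using d0 by (auto simp: d_def)
  define B where "B n = {s \<in> space S. norm (xs n s - x s) \<ge> d}" for n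
  have [measurable]: "B n \<in> sets S" for n
    unfolding B_def by measurable
  \<comment> \<open>The limit is written \<open>ennreal 0\<close> so that
    \<open>tendsto_ennreal_iff\<close> can pass to real measures.\<close>
  have "(\<lambda>n. emeasure S (B n)) \<longlonglongrightarrow> ennreal 0"
    using conv d unfolding converges_in_measure_def B_def by simp
  then have "(\<lambda>n. measure S (B n)) \<longlonglongrightarrow> 0"
    by (simp add: emeasure_eq_measure tendsto_ennreal_iff del: ennreal_0)
  then have "(\<lambda>n. 2 * M * measure S (B n)) \<longlonglongrightarrow> 0"
    by (rule tendsto_mult_right_zero)
  \<comment> \<open>Only \<open>B n\<close> varies with \<open>n\<close>; the other two thirds are
    already bounded independently of \<open>n\<close>.\<close>
  then obtain N where N: "\<And>n. n \<ge> N \<Longrightarrow> 2 * M * measure S (B n) < e / 3"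
    using \<open>0 < e\<close> order_tendstoD(2)[of _ 0 sequentially "e / 3"]
    by (fastforce simp: eventually_sequentially)
  have "norm ((\<integral>s. \<bar>f (xs n s) - f (x s)\<bar> \<partial>S) - 0) < e" if "n \<ge> N" for n
  proof -
    \<comment> \<open>Where \<open>A\<close> and \<open>B n\<close> overlap, the two indicator terms
      add up, which only weakens the bound.\<close>
    have pt: "\<bar>f (xs n s) - f (x s)\<bar> \<le> c + 2 * M * indicator A s + 2 * M * indicator (B n) s"
      if s: "s \<in> space S" for s
    proof (cases "s \<in> A \<or> s \<in> B n")
      case True
      then show ?thesis
        using bd[of "xs n s"] bd[of "x s"] M0 c by (auto simp: indicator_def)
    next
      case False
      then have "norm (x s) < R" "norm (xs n s - x s) < d"
        using s by (auto simp: A_def B_def)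
      moreover have "norm (xs n s) \<le> norm (x s) + norm (xs n s - x s)"
        by (rule norm_triangle_sub)
      ultimately have "dist (f (xs n s)) (f (x s)) < c"
        using d by (intro d0(2)) (auto simp: dist_norm)
      then show ?thesis
        using False by (simp add: dist_real_def)
    qed
    have int: "integrable S (\<lambda>s. f (xs n s))" "integrable S (\<lambda>s. f (x s))"
      by (rule continuous_bounded_integrable_comp[OF \<open>finite_measure S\<close> cont bd]; measurable)+
    have "(\<integral>s. \<bar>f (xs n s) - f (x s)\<bar> \<partial>S)
        \<le> (\<integral>s. c + 2 * M * indicator A s + 2 * M * indicator (B n) s \<partial>S)"
      using int pt by (intro integral_mono) (auto simp: emeasure_eq_measure)
    also have "\<dots> = c * measure S (space S) + 2 * M * measure S A + 2 * M * measure S (B n)"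
      by (simp add: emeasure_eq_measure)
    also have "\<dots> < e"
      using c(2) A N[OF that] by linarith
    finally show ?thesis
      by simp
  qed
  then show "\<exists>N. \<forall>n\<ge>N. norm ((\<integral>s. \<bar>f (xs n s) - f (x s)\<bar> \<partial>S) - 0) < e"
    by blast
qed

theorem theorem7p4:
  fixes S :: "'a measure"
    and \<phi> :: "real ^ 'd \<Rightarrow> ereal"
    and xs :: "nat \<Rightarrow> 'a \<Rightarrow> real ^ 'd"
    and x :: "'a \<Rightarrow> real ^ 'd"
    and M :: real
  assumes "finite_measure S"
    and "complete_measure S"
    and "emeasure S (space S) \<noteq> 0"
    and "\<And>v. \<phi> v > -\<infinity>"
    and "continuous_on UNIV \<phi>"
    and "\<And>n. integrable S (xs n)"
    and "integrable S x"
    and "converges_in_measure S xs x"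
    and "M > 0"
    and "\<And>v. \<bar>\<phi> v\<bar> \<le> ereal M"
    and "x \<in> Linf_space S
      \<or> (uniformly_continuous_on UNIV (\<lambda>v. real_of_ereal (\<phi> v))
         \<or> (\<exists>L. L-lipschitz_on UNIV (\<lambda>v. real_of_ereal (\<phi> v))))"
  shows "(\<lambda>n. ereal_integral S (\<lambda>s. \<bar>\<phi> (xs n s) - \<phi> (x s)\<bar>)) \<longlonglongrightarrow> 0
    \<and> (\<lambda>n. integral_functional S \<phi> (xs n)) \<longlonglongrightarrow> integral_functional S \<phi> x"
proof -
  interpret finite_measure S by fact
  define f where "f v = real_of_ereal (\<phi> v)" for v
  \<comment> \<open>The bound by \<open>M\<close> excludes infinite values, so the problem reduces
    to the real function \<open>f\<close>.\<close>
  have \<phi>: "\<phi> v = ereal (f v)" for v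
    unfolding f_def using assms(10)[of v] by (cases "\<phi> v") auto
  have bd: "\<bar>f v\<bar> \<le> M" for v
    using assms(10)[of v] by (simp add: \<phi>)
  have cont: "continuous_on UNIV f"
    using assms(5) unfolding \<phi>[abs_def] continuous_on_def by simp
  have meas: "x \<in> borel_measurable S" "\<And>n. xs n \<in> borel_measurable S"
    using assms(6,7) by auto
  have int: "integrable S (\<lambda>s. f (x s))" "\<And>n. integrable S (\<lambda>s. f (xs n s))"
    using continuous_bounded_integrable_comp[OF assms(1) cont bd] meas by blast+
  have mean: "(\<lambda>n. \<integral>s. \<bar>f (xs n s) - f (x s)\<bar> \<partial>S) \<longlonglongrightarrow> 0"
    by (rule bounded_continuous_converges_in_mean) (use assms meas cont bd in auto)
  \<comment> \<open>The difference of the integrals is dominated by the integral of the absolute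
    difference, which tends to 0 by \<open>mean\<close>.\<close>
  have "(\<lambda>n. (\<integral>s. f (xs n s) \<partial>S) - (\<integral>s. f (x s) \<partial>S)) \<longlonglongrightarrow> 0"
  proof (rule Lim_null_comparison[OF always_eventually mean], rule allI)
    show "norm ((\<integral>s. f (xs n s) \<partial>S) - (\<integral>s. f (x s) \<partial>S)) \<le> (\<integral>s. \<bar>f (xs n s) - f (x s)\<bar> \<partial>S)"
      for n
      using integral_norm_bound[of S "\<lambda>s. f (xs n s) - f (x s)"] int by simp
  qed
  then have "(\<lambda>n. \<integral>s. f (xs n s) \<partial>S) \<longlonglongrightarrow> (\<integral>s. f (x s) \<partial>S)"
    by (simp add: LIM_zero_iff)
  \<comment> \<open>Both claims are the real limits read through \<open>ereal\<close>, with 0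
    rewritten as \<open>ereal 0\<close>.\<close>
  then show ?thesis
    using mean int
    by (simp add: integral_functional_def \<phi> ereal_integral_ereal zero_ereal_def)
qed

end
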